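(* Let $H$ be a finite-dimensional real Hilbert space and let $f:H\to\mathbb{R}$ be convex, twice continuously differentiable and bounded below, with nonempty set of minimizers $X_\star$ and minimal value $f_\star$. Assume that for some $L_\nu>0$ and $\nu\in[0,1]$ one has $\|\nabla^2 f(x)-\nabla^2 f(y)\|\le L_\nu\|x-y\|^\nu$ for all $x,y\in H$, and that $D:=\sup\{\operatorname{dist}(x,X_\star): x\in H,\ f(x)\le f(x_0)\}<\infty$. Let $(x_k)_k$ be generated by the basic inexact trust-region method (described in the context) started at $x_0$. Then $$k_{\mathrm{TR},\mathrm{cvx}}(\varepsilon):=\min\{k\in\mathbb{N}: f(x_k)-f_\star\le\varepsilon\}=\mathcal{O}\bigl(\varepsilon^{-1/(1+\nu)}\bigr)\qquad(\varepsilon\downarrow0),$$ that is, there exist constants $C>0$ and $\varepsilon_0>0$, independent of $\varepsilon$ (they may depend on the problem data and the algorithmic parameters), such that $k_{\mathrm{TR},\mathrm{cvx}}(\varepsilon)\le C\varepsilon^{-1/(1+\nu)}$ for all $\varepsilon\in(0,\varepsilon_0]$.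
   Context: $\mathbb{N}=\{0,1,2,\dots\}$. Write $g_k:=\nabla f(x_k)$, $H_k:=\nabla^2 f(x_k)$ and $m_k(s):=f(x_k)+\langle g_k,s\rangle+\tfrac12\langle H_ks,s\rangle$. Basic inexact trust-region method. Inputs: $x_0\in H$, $\Delta_0>0$, constants $0<\eta_1\le\eta_2<1$, $0<\gamma_1\le\gamma_2<1\le\gamma_3$, a bound $\bar\tau>0$ and inexactness parameters $\tau_k\in[0,\bar\tau)$. For $k=0,1,2,\dots$: if $\|g_k\|=0$, terminate and return $x_k$. Otherwise compute a step $s_k\in H$ with $\|s_k\|\le\Delta_k$ and $$m_k(0)-m_k(s_k)\ge\frac{1}{1+\tau_k}\bigl(m_k(0)-m_k(s_k^\star)\bigr),\qquad s_k^\star\in\arg\min_{\|s\|\le\Delta_k}m_k(s).$$ Set $\rho_k:=\dfrac{f(x_k)-f(x_k+s_k)}{m_k(0)-m_k(s_k)}$. Set $x_{k+1}=x_k+s_k$ if $\rho_k\ge\eta_1$ and $x_{k+1}=x_k$ otherwise. Choose $\Delta_{k+1}$ arbitrarily in $[\gamma_1\Delta_k,\gamma_2\Delta_k]$ if $\rho_k<\eta_1$, in $[\gamma_2\Delta_k,\Delta_k]$ if $\eta_1\le\rho_k<\eta_2$, and in $[\Delta_k,\gamma_3\Delta_k]$ if $\rho_k\ge\eta_2$. Standing convention: the method does not terminate finitely, i.e. $\|\nabla f(x_k)\|>0$ and $f(x_k)-f_\star>0$ for all $k\in\mathbb{N}$. *)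

theory Defs
  imports "HOL-Analysis.Analysis"
begin

definition twice_cont_diff ::
  "('a::euclidean_space \<Rightarrow> real) \<Rightarrow> ('a \<Rightarrow> 'a) \<Rightarrow> ('a \<Rightarrow> 'a \<Rightarrow>\<^sub>L 'a) \<Rightarrow> bool"
where
  "twice_cont_diff f grad hess \<longleftrightarrow>
     (\<forall>x. GDERIV f x :> grad x) \<and>
     (\<forall>x. (grad has_derivative blinfun_apply (hess x)) (at x)) \<and>
     continuous_on UNIV hess"

definition minimizers :: "('a \<Rightarrow> real) \<Rightarrow> 'a set" where
  "minimizers f = {x. \<forall>y. f x \<le> f y}"

definition min_value :: "('a \<Rightarrow> real) \<Rightarrow> real" where
  "min_value f = (INF x. f x)"

text \<open>The supremum is formed in the extended reals, so that its finiteness is a genuine condition.\<close>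

definition sublevel_radius :: "('a::euclidean_space \<Rightarrow> real) \<Rightarrow> 'a \<Rightarrow> ereal" where
  "sublevel_radius f x\<^sub>0 = (SUP x\<in>{x. f x \<le> f x\<^sub>0}. ereal (infdist x (minimizers f)))"

definition quad_model ::
  "('a::euclidean_space \<Rightarrow> real) \<Rightarrow> ('a \<Rightarrow> 'a) \<Rightarrow> ('a \<Rightarrow> 'a \<Rightarrow>\<^sub>L 'a) \<Rightarrow> 'a \<Rightarrow> 'a \<Rightarrow> real"
where
  "quad_model f grad hess x s = f x + grad x \<bullet> s + (1/2) * (blinfun_apply (hess x) s \<bullet> s)"

definition inexact_tr_step ::
  "('a::euclidean_space \<Rightarrow> real) \<Rightarrow> real \<Rightarrow> real \<Rightarrow> 'a \<Rightarrow> bool"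
where
  "inexact_tr_step m \<Delta> \<tau> s \<longleftrightarrow>
     norm s \<le> \<Delta> \<and>
     (\<exists>s\<^sub>o\<^sub>p\<^sub>t. is_arg_min m (\<lambda>u. norm u \<le> \<Delta>) s\<^sub>o\<^sub>p\<^sub>t \<and>
        m 0 - m s \<ge> 1 / (1 + \<tau>) * (m 0 - m s\<^sub>o\<^sub>p\<^sub>t))"

definition tr_ratio ::
  "('a::euclidean_space \<Rightarrow> real) \<Rightarrow> ('a \<Rightarrow> 'a) \<Rightarrow> ('a \<Rightarrow> 'a \<Rightarrow>\<^sub>L 'a) \<Rightarrow> 'a \<Rightarrow> 'a \<Rightarrow> real"
where
  "tr_ratio f grad hess x s =
     (f x - f (x + s)) / (quad_model f grad hess x 0 - quad_model f grad hess x s)"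

definition tr_radius_update ::
  "real \<Rightarrow> real \<Rightarrow> real \<Rightarrow> real \<Rightarrow> real \<Rightarrow> real \<Rightarrow> real \<Rightarrow> real set"
where
  "tr_radius_update \<eta>\<^sub>1 \<eta>\<^sub>2 \<gamma>\<^sub>1 \<gamma>\<^sub>2 \<gamma>\<^sub>3 \<rho> \<Delta> =
     (if \<rho> < \<eta>\<^sub>1 then {\<gamma>\<^sub>1 * \<Delta>..\<gamma>\<^sub>2 * \<Delta>}
      else if \<rho> < \<eta>\<^sub>2 then {\<gamma>\<^sub>2 * \<Delta>..\<Delta>}
      else {\<Delta>..\<gamma>\<^sub>3 * \<Delta>})"

text \<open>
  \<open>x\<close>, \<open>s\<close> and \<open>\<Delta>\<close> are the iterates, steps and radii of one of the many possible executions
  (the steps and the new radii are not uniquely determined). The method stops as soon as the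
  gradient vanishes, so the entries of the sequences after such an index are unconstrained.
\<close>

definition tr_run ::
  "('a::euclidean_space \<Rightarrow> real) \<Rightarrow> ('a \<Rightarrow> 'a) \<Rightarrow> ('a \<Rightarrow> 'a \<Rightarrow>\<^sub>L 'a) \<Rightarrow>
   real \<Rightarrow> real \<Rightarrow> real \<Rightarrow> real \<Rightarrow> real \<Rightarrow> (nat \<Rightarrow> real) \<Rightarrow> 'a \<Rightarrow> real \<Rightarrow>
   (nat \<Rightarrow> 'a) \<Rightarrow> (nat \<Rightarrow> 'a) \<Rightarrow> (nat \<Rightarrow> real) \<Rightarrow> bool"
where
  "tr_run f grad hess \<eta>\<^sub>1 \<eta>\<^sub>2 \<gamma>\<^sub>1 \<gamma>\<^sub>2 \<gamma>\<^sub>3 \<tau> x\<^sub>0 \<Delta>\<^sub>0 x s \<Delta> \<longleftrightarrow>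
     x 0 = x\<^sub>0 \<and> \<Delta> 0 = \<Delta>\<^sub>0 \<and>
     (\<forall>k. norm (grad (x k)) \<noteq> 0 \<longrightarrow>
        (let \<rho> = tr_ratio f grad hess (x k) (s k) in
           inexact_tr_step (quad_model f grad hess (x k)) (\<Delta> k) (\<tau> k) (s k) \<and>
           x (Suc k) = (if \<rho> \<ge> \<eta>\<^sub>1 then x k + s k else x k) \<and>
           \<Delta> (Suc k) \<in> tr_radius_update \<eta>\<^sub>1 \<eta>\<^sub>2 \<gamma>\<^sub>1 \<gamma>\<^sub>2 \<gamma>\<^sub>3 \<rho> (\<Delta> k)))"

text \<open>
  \<open>LEAST\<close> is only meaningful if some index qualifies; statements about \<open>k_tr_cvx\<close> must therefore
  assert the existence of such an index as well.
\<close>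

definition k_tr_cvx :: "('a \<Rightarrow> real) \<Rightarrow> (nat \<Rightarrow> 'a) \<Rightarrow> real \<Rightarrow> nat" where
  "k_tr_cvx f x \<epsilon> = (LEAST k. f (x k) - min_value f \<le> \<epsilon>)"

end

theory Submission
  imports Defs
begin

text \<open>
  Write \<open>\<phi>\<^sub>k = f x\<^sub>k - f\<^sub>*\<close>, \<open>p = 1 / (1 + \<nu>)\<close>. The model errs by \<open>O(\<Delta> powr (2 + \<nu>))\<close>, while by
  convexity a step of length \<open>r\<close> towards a minimizer at distance at most \<open>R\<close> gains \<open>r * \<phi>\<^sub>k / R\<close>. The
  gain dominates as long as \<open>r \<le> \<kappa> * \<phi>\<^sub>k powr p\<close>, so no radius below this threshold is ever reduced and
  \<open>\<Delta>\<^sub>k \<ge> c * \<phi>\<^sub>k powr p\<close> throughout. A successful step therefore lowers \<open>\<phi>\<^sub>k\<close> by a multiple of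
  \<open>\<phi>\<^sub>k powr (1 + p)\<close>, that is, raises \<open>\<phi>\<^sub>k powr (- p)\<close> by a constant. Unsuccessful steps shrink the
  radius geometrically and are paid for by its lower bound, at the cost of a term \<open>ln (1 / \<phi>\<^sub>k)\<close> only.
\<close>

section \<open>Taylor error of the quadratic model\<close>

lemma quad_model_zero [simp]: "quad_model f grad hess x 0 = f x"
  by (simp add: quad_model_def blinfun.zero_right)

text \<open>Taylor's formula along the segment from \<open>x\<close> to \<open>x + s\<close>, with
  Lagrange remainder: the model differs from \<open>f\<close> only by having the Hessian at
  \<open>x\<close> in place of an intermediate point, and the Hoelder condition controls that
  difference. The factor \<open>L / 2\<close> is not sharp; the integral remainder would give
  \<open>L / ((1 + \<nu>) * (2 + \<nu>))\<close>.\<close>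

lemma quad_model_error:
  fixes f :: "'a::euclidean_space \<Rightarrow> real"
  assumes tcd: "twice_cont_diff f grad hess"
    and hoelder: "\<And>x y. norm (hess x - hess y) \<le> L * norm (x - y) powr \<nu>"
    and "0 \<le> L" "0 \<le> \<nu>"
  shows "\<bar>f (x + s) - quad_model f grad hess x s\<bar> \<le> L / 2 * norm s powr (2 + \<nu>)"
proof -
  define h where "h = (\<lambda>t. f (x + t *\<^sub>R s))"
  define h' where "h' = (\<lambda>t. grad (x + t *\<^sub>R s) \<bullet> s)"
  define h'' where "h'' = (\<lambda>t. blinfun_apply (hess (x + t *\<^sub>R s)) s \<bullet> s)"
  have gf: "(f has_derivative (\<lambda>v. v \<bullet> grad y)) (at y)" for y
    using tcd by (simp add: twice_cont_diff_def gderiv_def)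
  have gg: "(grad has_derivative blinfun_apply (hess y)) (at y)" for y
    using tcd by (simp add: twice_cont_diff_def)
  have line: "((\<lambda>t. x + t *\<^sub>R s) has_derivative (\<lambda>t. t *\<^sub>R s)) (at t)" for t
    by (auto intro!: derivative_eq_intros)
  have d1: "DERIV h t :> h' t" for t
    unfolding h_def
    by (rule has_derivative_imp_has_field_derivative[OF has_derivative_compose[OF line gf]])
      (simp add: h'_def inner_commute)
  have d2: "DERIV h' t :> h'' t" for t
    unfolding h'_def
    by (rule has_derivative_imp_has_field_derivative
          [OF has_derivative_inner_left[OF has_derivative_compose[OF line gg]]])
      (simp add: h''_def blinfun.scaleR_right)
  define d where "d = (\<lambda>n::nat. if n = 0 then h else if n = 1 then h' else h'')"
  have "\<exists>t>0. t < 1 \<and> h 1 = (\<Sum>m<2. d m 0 / fact m * 1 ^ m) + d 2 t / fact 2 * 1 ^ 2"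
    by (rule Maclaurin) (auto simp: d_def d1 d2 less_2_cases_iff)
  then obtain t where t: "0 < t" "t < 1" and "h 1 = h 0 + h' 0 + h'' t / 2"
    by (auto simp: d_def numeral_2_eq_2)
  then have "f (x + s) - quad_model f grad hess x s
      = (blinfun_apply (hess (x + t *\<^sub>R s) - hess x) s \<bullet> s) / 2"
    by (simp add: h_def h'_def h''_def quad_model_def blinfun.diff_left inner_diff_left field_simps)
  moreover have "\<bar>blinfun_apply (hess (x + t *\<^sub>R s) - hess x) s \<bullet> s\<bar> \<le> L * norm s powr (2 + \<nu>)"
  proof -
    have "\<bar>blinfun_apply (hess (x + t *\<^sub>R s) - hess x) s \<bullet> s\<bar>
        \<le> norm (blinfun_apply (hess (x + t *\<^sub>R s) - hess x) s) * norm s"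
      by (rule Cauchy_Schwarz_ineq2)
    also have "\<dots> \<le> (norm (hess (x + t *\<^sub>R s) - hess x) * norm s) * norm s"
      by (intro mult_right_mono norm_blinfun) auto
    also have "\<dots> \<le> ((L * norm s powr \<nu>) * norm s) * norm s"
    proof (intro mult_right_mono)
      have "norm (hess (x + t *\<^sub>R s) - hess x) \<le> L * norm (t *\<^sub>R s) powr \<nu>"
        using hoelder[of "x + t *\<^sub>R s" x] by simp
      also have "\<dots> \<le> L * norm s powr \<nu>"
        using assms t by (intro mult_left_mono powr_mono2) (auto simp: mult_left_le_one_le)
      finally show "norm (hess (x + t *\<^sub>R s) - hess x) \<le> L * norm s powr \<nu>" .
    qed auto
    also have "\<dots> = L * norm s powr (2 + \<nu>)"
      by (cases "s = 0") (simp_all add: powr_add power2_eq_square)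
    finally show ?thesis .
  qed
  ultimately show ?thesis by linarith
qed

section \<open>Guaranteed progress in a single iteration\<close>

text \<open>The optimal model step is compared with the trial step \<open>u\<close> of length at
  most \<open>r\<close> towards \<open>z\<close>. Convexity gives \<open>u\<close> the gain
  \<open>r / R * (f x - f z)\<close>, and the size condition on \<open>r\<close> lets the model
  error consume at most half of it. The inexact step keeps the fraction
  \<open>1 / (1 + \<tau>)\<close>.\<close>

lemma tr_model_decrease:
  fixes f :: "'a::euclidean_space \<Rightarrow> real"
  assumes cvx: "convex_on UNIV f"
    and err: "\<And>u. \<bar>f (x + u) - quad_model f grad hess x u\<bar> \<le> L / 2 * norm u powr (2 + \<nu>)"
    and step: "inexact_tr_step (quad_model f grad hess x) \<Delta> \<tau> s"
    and pos: "0 \<le> L" "0 \<le> \<nu>" "0 \<le> \<tau>"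
    and r: "0 < r" "r \<le> R" "r \<le> \<Delta>" "L * R * r powr (1 + \<nu>) \<le> f x - f z"
    and z: "norm (z - x) \<le> R"
  shows "r * (f x - f z) / (2 * R * (1 + \<tau>)) \<le> f x - quad_model f grad hess x s"
proof -
  let ?m = "quad_model f grad hess x"
  define \<alpha> where "\<alpha> = r / R"
  define u where "u = \<alpha> *\<^sub>R (z - x)"
  have \<alpha>: "0 < \<alpha>" "\<alpha> \<le> 1" "\<alpha> * R = r" using r by (auto simp: \<alpha>_def)
  have nu: "norm u \<le> r"
    using z \<alpha> by (simp add: u_def mult_left_mono flip: \<alpha>(3))
  obtain v where v: "is_arg_min ?m (\<lambda>u. norm u \<le> \<Delta>) v" "?m 0 - ?m s \<ge> 1 / (1 + \<tau>) * (?m 0 - ?m v)"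
    using step by (auto simp: inexact_tr_step_def)
  have mv: "?m v \<le> ?m u"
    using v(1) nu r(3) by (auto simp: is_arg_min_def not_less)
  have "x + u = (1 - \<alpha>) *\<^sub>R x + \<alpha> *\<^sub>R z" by (simp add: u_def algebra_simps)
  then have "f (x + u) \<le> (1 - \<alpha>) * f x + \<alpha> * f z"
    using convex_onD[OF cvx, of \<alpha> x z] \<alpha> by simp
  then have fu: "f x - f (x + u) \<ge> \<alpha> * (f x - f z)" by (simp add: algebra_simps)
  have "L / 2 * norm u powr (2 + \<nu>) \<le> L / 2 * r powr (2 + \<nu>)"
    using nu pos by (intro mult_left_mono powr_mono2) auto
  also have "\<dots> = \<alpha> / 2 * (L * R * r powr (1 + \<nu>))"
  proof -
    have "r powr (2 + \<nu>) = r powr (1 + (1 + \<nu>))" by (simp add: add.assoc[symmetric])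
    also have "\<dots> = \<alpha> * R * r powr (1 + \<nu>)" unfolding powr_add[of r 1] using \<alpha> r by simp
    finally show ?thesis by simp
  qed
  also have "\<dots> \<le> \<alpha> / 2 * (f x - f z)"
    using r \<alpha> by (intro mult_left_mono) auto
  finally have "\<bar>f (x + u) - ?m u\<bar> \<le> \<alpha> * (f x - f z) / 2"
    using err[of u] by linarith
  then have "?m 0 - ?m v \<ge> \<alpha> * (f x - f z) / 2"
    using fu mv unfolding quad_model_zero abs_le_iff by argo
  then have "1 / (1 + \<tau>) * (\<alpha> * (f x - f z) / 2) \<le> 1 / (1 + \<tau>) * (?m 0 - ?m v)"
    using pos by (intro mult_left_mono) auto
  with v(2) show ?thesis using r by (simp add: \<alpha>_def mult_ac)
qed

text \<open>With \<open>u = a * \<phi> powr p\<close>, the decrease reads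
  \<open>\<phi>' \<le> \<phi> * (1 - u)\<close>, and Bernoulli's inequality
  \<open>(1 - u) powr (- p) \<ge> 1 + p * u\<close> turns it into an additive increment: the factor
  \<open>\<phi> powr p\<close> in \<open>u\<close> cancels \<open>\<phi> powr (- p)\<close>.\<close>

lemma powr_neg_increment:
  fixes \<phi> \<phi>' a p :: real
  assumes "0 < p" "0 \<le> a" "0 < \<phi>'" "0 < \<phi>" and dec: "\<phi>' \<le> \<phi> - a * \<phi> powr p * \<phi>"
  shows "\<phi> powr (- p) + p * a \<le> \<phi>' powr (- p)"
proof -
  define u where "u = a * \<phi> powr p"
  have d: "\<phi>' \<le> \<phi> * (1 - u)" using dec by (simp add: u_def algebra_simps)
  \<comment> \<open>Positivity of \<open>\<phi>'\<close> is what forces \<open>u < 1\<close>, so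
    that the logarithm of \<open>1 - u\<close> can be used.\<close>
  have "0 < \<phi> * (1 - u)" using d assms by linarith
  then have u1: "0 < 1 - u" using assms by (simp add: zero_less_mult_iff)
  have "1 + p * u \<le> exp (p * u)" by (rule exp_ge_add_one_self)
  also have "\<dots> \<le> exp (- p * ln (1 - u))"
    using mult_left_mono[OF ln_le_minus_one[OF u1], of p] assms by simp
  also have "\<dots> = (1 - u) powr (- p)" using u1 by (simp add: powr_def)
  finally have "\<phi> powr (- p) * (1 + p * u) \<le> \<phi> powr (- p) * (1 - u) powr (- p)"
    by (intro mult_left_mono) auto
  also have "\<dots> = (\<phi> * (1 - u)) powr (- p)" using u1 assms by (simp add: powr_mult)
  also have "\<dots> \<le> \<phi>' powr (- p)" using d assms by (intro powr_mono2') auto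
  finally show ?thesis using assms by (simp add: u_def algebra_simps powr_minus)
qed

text \<open>The previous estimate is applied with \<open>r = min \<Delta> (\<kappa> * q)\<close>.
  Below the threshold \<open>\<kappa> * q\<close> this \<open>r\<close> is the radius itself, so it
  also bounds the actual step, and the second condition in \<open>\<kappa>\<close> keeps the model
  error within the fraction \<open>1 - \<eta>\<close> of the predicted decrease.\<close>

lemma tr_iteration:
  fixes f :: "'a::euclidean_space \<Rightarrow> real"
  assumes cvx: "convex_on UNIV f"
    and err: "\<And>u. \<bar>f (x + u) - quad_model f grad hess x u\<bar> \<le> L / 2 * norm u powr (2 + \<nu>)"
    and step: "inexact_tr_step (quad_model f grad hess x) \<Delta> \<tau> s"
    and pos: "0 < L" "0 \<le> \<nu>" "0 \<le> \<tau>" "\<tau> \<le> \<tau>'" "0 < \<Delta>" "0 < R" "0 < \<kappa>" "0 < \<eta>"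
    and z: "norm (z - x) \<le> R" "f z < f x"
    and q: "q = (f x - f z) powr (1 / (1 + \<nu>))"
    and \<kappa>: "\<kappa> * q \<le> R" "L * R * (1 + \<tau>') * \<kappa> powr (1 + \<nu>) \<le> 1 - \<eta>"
  shows "min \<Delta> (\<kappa> * q) * (f x - f z) / (2 * R * (1 + \<tau>')) \<le> f x - quad_model f grad hess x s"
    and "0 < f x - quad_model f grad hess x s"
    and "\<Delta> \<le> \<kappa> * q \<Longrightarrow> \<eta> \<le> tr_ratio f grad hess x s"
proof -
  define \<phi> where "\<phi> = f x - f z"
  define r where "r = min \<Delta> (\<kappa> * q)"
  define pred where "pred = f x - quad_model f grad hess x s"
  have \<phi>: "0 < \<phi>" using z by (simp add: \<phi>_def)
  have q0: "0 < q" "q powr (1 + \<nu>) = \<phi>" using \<phi> pos by (auto simp: q \<phi>_def powr_powr)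
  have r: "0 < r" "r \<le> \<Delta>" "r \<le> \<kappa> * q" "r \<le> R"
    using pos q0 \<kappa> by (auto simp: r_def min_def)
  \<comment> \<open>Used twice: with \<open>\<eta> > 0\<close> it yields the size condition on
    \<open>r\<close> for the model decrease, and in full it bounds the model error at
    \<open>s\<close>.\<close>
  have rb: "L * R * (1 + \<tau>') * r powr (1 + \<nu>) \<le> (1 - \<eta>) * \<phi>"
  proof -
    have "r powr (1 + \<nu>) \<le> (\<kappa> * q) powr (1 + \<nu>)" using r pos by (intro powr_mono2) auto
    also have "\<dots> = \<kappa> powr (1 + \<nu>) * \<phi>" using q0 pos by (simp add: powr_mult)
    finally have "L * R * (1 + \<tau>') * r powr (1 + \<nu>) \<le> L * R * (1 + \<tau>') * (\<kappa> powr (1 + \<nu>) * \<phi>)"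
      using pos by (intro mult_left_mono) auto
    also have "\<dots> \<le> (1 - \<eta>) * \<phi>"
      using mult_right_mono[OF \<kappa>(2), of \<phi>] \<phi> by (simp add: mult_ac)
    finally show ?thesis .
  qed
  have "L * R * r powr (1 + \<nu>) \<le> L * R * (1 + \<tau>') * r powr (1 + \<nu>)"
    using pos by (intro mult_right_mono) auto
  also have "\<dots> \<le> \<phi>" using rb mult_pos_pos[OF pos(8) \<phi>] by (simp add: algebra_simps)
  finally have "r * \<phi> / (2 * R * (1 + \<tau>)) \<le> pred"
    unfolding pred_def \<phi>_def
    using tr_model_decrease[OF cvx err step _ _ _ r(1,4,2) _ z(1)] pos by simp
  moreover have "r * \<phi> / (2 * R * (1 + \<tau>')) \<le> r * \<phi> / (2 * R * (1 + \<tau>))"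
    using pos r \<phi> by (intro divide_left_mono mult_left_mono) auto
  ultimately have pred: "r * \<phi> / (2 * R * (1 + \<tau>')) \<le> pred" by simp
  then show "min \<Delta> (\<kappa> * q) * (f x - f z) / (2 * R * (1 + \<tau>')) \<le> f x - quad_model f grad hess x s"
    by (simp add: r_def \<phi>_def pred_def)
  have "0 < r * \<phi> / (2 * R * (1 + \<tau>'))" using pos r \<phi> by simp
  with pred have pred0: "0 < pred" by simp
  then show "0 < f x - quad_model f grad hess x s" by (simp add: pred_def)
  assume "\<Delta> \<le> \<kappa> * q"
  then have [simp]: "r = \<Delta>" by (simp add: r_def)
  have "norm s \<le> r" using step by (simp add: inexact_tr_step_def)
  then have "L / 2 * norm s powr (2 + \<nu>) \<le> L / 2 * r powr (2 + \<nu>)"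
    using pos by (intro mult_left_mono powr_mono2) auto
  also have "\<dots> = r / (2 * R * (1 + \<tau>')) * (L * R * (1 + \<tau>') * r powr (1 + \<nu>))"
  proof -
    have "r powr (2 + \<nu>) = r powr (1 + (1 + \<nu>))" by (simp add: add.assoc[symmetric])
    also have "\<dots> = r * r powr (1 + \<nu>)" unfolding powr_add[of r 1] using r by simp
    finally have "r powr (2 + \<nu>) = r * r powr (1 + \<nu>)" .
    moreover define T where "T = 1 + \<tau>'"
    moreover have "0 < T" using pos by (simp add: T_def)
    ultimately show ?thesis using pos by (simp flip: T_def)
  qed
  also have "\<dots> \<le> r / (2 * R * (1 + \<tau>')) * ((1 - \<eta>) * \<phi>)"
    using rb pos r by (intro mult_left_mono) auto
  also have "\<dots> = (1 - \<eta>) * (r * \<phi> / (2 * R * (1 + \<tau>')))" by simp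
  also have "\<dots> \<le> (1 - \<eta>) * pred"
  proof (intro mult_left_mono pred)
    \<comment> \<open>The bound \<open>\<eta> \<le> 1\<close> is read off from
      \<open>\<kappa>(2)\<close>, whose left side is nonnegative.\<close>
    have "0 \<le> L * R * (1 + \<tau>') * \<kappa> powr (1 + \<nu>)" using pos by simp
    with \<kappa>(2) show "0 \<le> 1 - \<eta>" by linarith
  qed
  finally have "\<bar>f (x + s) - quad_model f grad hess x s\<bar> \<le> (1 - \<eta>) * pred"
    using err[of s] by linarith
  then have "\<eta> * pred \<le> f x - f (x + s)"
    unfolding left_diff_distrib abs_le_iff by (simp add: pred_def)
  then show "\<eta> \<le> tr_ratio f grad hess x s"
    using pred0 by (simp add: tr_ratio_def pred_def pos_le_divide_eq)
qed

section \<open>Counting iterations by a potential\<close>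

text \<open>
  Every iteration increases the potential \<open>A * \<phi> powr (- p) - ln \<Delta>\<close> by at least \<open>- ln \<gamma>\<^sub>2\<close>: an
  unsuccessful one through the radius, and a successful one because \<open>A\<close> is large enough to make up
  for a radius enlarged by \<open>\<gamma>\<^sub>3\<close>.
\<close>

lemma potential_iteration_bound:
  fixes \<phi> \<Delta> :: "nat \<Rightarrow> real"
  assumes pos: "0 < p" "0 < a" "0 < c" "0 < \<gamma>\<^sub>2" "\<gamma>\<^sub>2 < 1" "1 \<le> \<gamma>\<^sub>3"
    and \<phi>: "\<And>k. 0 < \<phi> k"
    and low: "\<And>k. c * \<phi> k powr p \<le> \<Delta> k"
    and alt: "\<And>k. \<phi> (Suc k) \<le> \<phi> k - a * \<phi> k powr p * \<phi> k \<and> \<Delta> (Suc k) \<le> \<gamma>\<^sub>3 * \<Delta> k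
      \<or> \<phi> (Suc k) = \<phi> k \<and> \<Delta> (Suc k) \<le> \<gamma>\<^sub>2 * \<Delta> k"
  shows "real k * (- ln \<gamma>\<^sub>2)
    \<le> ((ln \<gamma>\<^sub>3 - ln \<gamma>\<^sub>2) / (p * a) + 1 / c) * \<phi> k powr (- p) + ln (\<Delta> 0)"
proof -
  define A where "A = (ln \<gamma>\<^sub>3 - ln \<gamma>\<^sub>2) / (p * a)"
  define V where "V = (\<lambda>k. A * \<phi> k powr (- p) - ln (\<Delta> k))"
  have g: "ln \<gamma>\<^sub>2 < 0" "0 \<le> ln \<gamma>\<^sub>3" using pos by auto
  have A: "0 \<le> A" using g pos by (simp add: A_def)
  have \<Delta>: "0 < \<Delta> k" for k
    using low[of k] \<phi>[of k] pos by (metis less_le_trans mult_pos_pos powr_gt_zero less_irrefl)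
  have increase: "V k - ln \<gamma>\<^sub>2 \<le> V (Suc k)" for k
    using alt[of k]
  proof (elim disjE conjE)
    assume "\<phi> (Suc k) \<le> \<phi> k - a * \<phi> k powr p * \<phi> k" and d: "\<Delta> (Suc k) \<le> \<gamma>\<^sub>3 * \<Delta> k"
    then have "\<phi> k powr (- p) + p * a \<le> \<phi> (Suc k) powr (- p)"
      using powr_neg_increment \<phi> pos by simp
    from mult_left_mono[OF this A]
    have "A * \<phi> k powr (- p) + (ln \<gamma>\<^sub>3 - ln \<gamma>\<^sub>2) \<le> A * \<phi> (Suc k) powr (- p)"
      using pos by (simp add: A_def distrib_left)
    moreover have "ln (\<Delta> (Suc k)) \<le> ln (\<gamma>\<^sub>3 * \<Delta> k)" using d \<Delta> pos by simp
    then have "ln (\<Delta> (Suc k)) \<le> ln \<gamma>\<^sub>3 + ln (\<Delta> k)" using \<Delta>[of k] pos by (simp add: ln_mult)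
    ultimately show ?thesis by (simp add: V_def)
  next
    assume "\<phi> (Suc k) = \<phi> k" and d: "\<Delta> (Suc k) \<le> \<gamma>\<^sub>2 * \<Delta> k"
    moreover have "ln (\<Delta> (Suc k)) \<le> ln (\<gamma>\<^sub>2 * \<Delta> k)" using d \<Delta> pos by simp
    then have "ln (\<Delta> (Suc k)) \<le> ln \<gamma>\<^sub>2 + ln (\<Delta> k)" using \<Delta>[of k] pos by (simp add: ln_mult)
    ultimately show ?thesis by (simp add: V_def)
  qed
  have "V 0 + real k * (- ln \<gamma>\<^sub>2) \<le> V k"
  proof (induction k)
    case (Suc k)
    then show ?case using increase[of k] by (simp add: algebra_simps)
  qed simp
  moreover have "- ln (\<Delta> 0) \<le> V 0" using A by (simp add: V_def)
  \<comment> \<open>The crude bound \<open>ln y \<le> y\<close> at \<open>y = 1 / \<Delta> k\<close>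
    absorbs the logarithmic cost of the unsuccessful iterations into the same power of
    \<open>\<phi> k\<close>.\<close>
  moreover have "- ln (\<Delta> k) \<le> 1 / c * \<phi> k powr (- p)"
  proof -
    have "- ln (\<Delta> k) \<le> 1 / \<Delta> k" using ln_le_minus_one[of "1 / \<Delta> k"] \<Delta>[of k] by (simp add: ln_div)
    also have "\<dots> \<le> 1 / (c * \<phi> k powr p)"
      using low[of k] \<Delta>[of k] \<phi>[of k] pos by (intro divide_left_mono) auto
    finally show ?thesis by (simp add: powr_minus field_simps)
  qed
  ultimately show ?thesis unfolding V_def A_def[symmetric] distrib_right by linarith
qed

section \<open>Gap bound along a run\<close>

text \<open>All constants are fixed from the data before any run is considered, so \<open>C\<close>
  serves every execution. Bounding the index by the gap at that index allows the target accuracy to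
  be inserted later.\<close>

lemma tr_run_gap_bound:
  fixes f :: "'a::euclidean_space \<Rightarrow> real"
  assumes cvx: "convex_on UNIV f"
    and tcd: "twice_cont_diff f grad hess"
    and pos: "L > 0" "0 \<le> \<nu>" "\<Delta>\<^sub>0 > 0" "0 < R" "0 < w"
    and hoelder: "\<And>x y. norm (hess x - hess y) \<le> L * norm (x - y) powr \<nu>"
    and near: "\<And>y. f y \<le> f x\<^sub>0 \<Longrightarrow> \<exists>z. f z = fmin \<and> norm (z - y) \<le> R"
    and w: "f x\<^sub>0 - fmin \<le> w"
    and \<eta>: "0 < \<eta>\<^sub>1" "\<eta>\<^sub>1 \<le> \<eta>\<^sub>2" "\<eta>\<^sub>2 < 1"
    and \<gamma>: "0 < \<gamma>\<^sub>1" "\<gamma>\<^sub>1 \<le> \<gamma>\<^sub>2" "\<gamma>\<^sub>2 < 1" "1 \<le> \<gamma>\<^sub>3"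
    and \<tau>: "\<And>k. 0 \<le> \<tau> k \<and> \<tau> k \<le> \<tau>'"
  shows "\<exists>C. \<forall>x s \<Delta>. tr_run f grad hess \<eta>\<^sub>1 \<eta>\<^sub>2 \<gamma>\<^sub>1 \<gamma>\<^sub>2 \<gamma>\<^sub>3 \<tau> x\<^sub>0 \<Delta>\<^sub>0 x s \<Delta> \<longrightarrow>
           (\<forall>k. norm (grad (x k)) > 0 \<and> f (x k) - fmin > 0) \<longrightarrow>
           (\<forall>k. real k \<le> C * (f (x k) - fmin) powr (- 1 / (1 + \<nu>)) + ln \<Delta>\<^sub>0 / (- ln \<gamma>\<^sub>2))"
proof -
  define p where "p = 1 / (1 + \<nu>)"
  define T where "T = 1 + \<tau>'"
  \<comment> \<open>\<open>B\<close> is the largest value of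
    \<open>\<kappa> powr (1 + \<nu>)\<close> that the ratio test with \<open>\<eta>\<^sub>2\<close>
    tolerates. The other bound in \<open>\<kappa>\<close> keeps the trial length
    \<open>\<kappa> * \<phi> k powr p\<close> below \<open>R\<close>, as the gap never exceeds
    \<open>w\<close>.\<close>
  define B where "B = (1 - \<eta>\<^sub>2) / (L * R * T)"
  define \<kappa> where "\<kappa> = min (R / w powr p) (B powr p)"
  \<comment> \<open>The first term covers the initial radius; the second allows one reduction by
    \<open>\<gamma>\<^sub>1\<close> from a radius above the threshold.\<close>
  define c where "c = min (\<Delta>\<^sub>0 / w powr p) (\<gamma>\<^sub>1 * \<kappa>)"
  \<comment> \<open>The factor \<open>\<eta>\<^sub>1\<close> is the share of the predicted decrease
    that an accepted step realizes at least.\<close>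
  define a where "a = \<eta>\<^sub>1 * c / (2 * R * T)"
  define C where "C = ((ln \<gamma>\<^sub>3 - ln \<gamma>\<^sub>2) / (p * a) + 1 / c) / (- ln \<gamma>\<^sub>2)"
  have p: "0 < p" using pos by (simp add: p_def)
  have \<tau>': "0 \<le> \<tau>'" using \<tau>[of 0] by linarith
  have T: "1 \<le> T" using \<tau>' by (simp add: T_def)
  have B: "0 < B" using \<eta> pos T by (simp add: B_def)
  have \<kappa>: "0 < \<kappa>" using pos B by (simp add: \<kappa>_def)
  have c: "0 < c" using \<kappa> \<gamma> pos by (simp add: c_def)
  have a: "0 < a" using c \<eta> pos T by (simp add: a_def)
  have "c \<le> \<gamma>\<^sub>1 * \<kappa>" by (simp add: c_def)
  also have "\<dots> \<le> 1 * \<kappa>" using \<gamma> \<kappa> by (intro mult_right_mono) auto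
  finally have c\<kappa>: "c \<le> \<kappa>" by simp
  have \<kappa>B: "L * R * (1 + \<tau>') * \<kappa> powr (1 + \<nu>) \<le> 1 - \<eta>\<^sub>2"
  proof -
    have "\<kappa> powr (1 + \<nu>) \<le> (B powr p) powr (1 + \<nu>)"
      using \<kappa> pos by (intro powr_mono2) (auto simp: \<kappa>_def)
    also have "\<dots> = B" using B pos by (simp add: powr_powr p_def)
    finally have "L * R * T * \<kappa> powr (1 + \<nu>) \<le> L * R * T * B"
      using pos T by (intro mult_left_mono) auto
    also have "\<dots> = 1 - \<eta>\<^sub>2" using pos T by (simp add: B_def)
    finally show ?thesis by (simp add: T_def)
  qed
  {
    fix x s \<Delta> k
    assume run: "tr_run f grad hess \<eta>\<^sub>1 \<eta>\<^sub>2 \<gamma>\<^sub>1 \<gamma>\<^sub>2 \<gamma>\<^sub>3 \<tau> x\<^sub>0 \<Delta>\<^sub>0 x s \<Delta>"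
      and live: "\<forall>k. norm (grad (x k)) > 0 \<and> f (x k) - fmin > 0"
    define \<phi> where "\<phi> = (\<lambda>k. f (x k) - fmin)"
    define \<rho> where "\<rho> = (\<lambda>k. tr_ratio f grad hess (x k) (s k))"
    define pred where "pred = (\<lambda>k. f (x k) - quad_model f grad hess (x k) (s k))"
    have \<phi>0: "0 < \<phi> k" for k using live by (simp add: \<phi>_def)
    have init: "x 0 = x\<^sub>0" "\<Delta> 0 = \<Delta>\<^sub>0" using run by (auto simp: tr_run_def)
    have step: "inexact_tr_step (quad_model f grad hess (x k)) (\<Delta> k) (\<tau> k) (s k)"
      and next_x: "x (Suc k) = (if \<rho> k \<ge> \<eta>\<^sub>1 then x k + s k else x k)"
      and next_\<Delta>: "\<Delta> (Suc k) \<in> tr_radius_update \<eta>\<^sub>1 \<eta>\<^sub>2 \<gamma>\<^sub>1 \<gamma>\<^sub>2 \<gamma>\<^sub>3 (\<rho> k) (\<Delta> k)" for k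
      using run live by (auto simp: tr_run_def Let_def \<rho>_def)
    \<comment> \<open>The two invariants are premises here because this fact drives the induction
      that establishes them.\<close>
    have iter: "c * \<phi> k powr p * \<phi> k / (2 * R * T) \<le> pred k \<and> 0 < pred k
        \<and> (\<Delta> k \<le> \<kappa> * \<phi> k powr p \<longrightarrow> \<eta>\<^sub>2 \<le> \<rho> k)"
      if sub: "f (x k) \<le> f x\<^sub>0" and low: "c * \<phi> k powr p \<le> \<Delta> k" for k
    proof -
      obtain z where z: "f z = fmin" "norm (z - x k) \<le> R" using near[OF sub] by blast
      have "\<phi> k powr p \<le> w powr p" using sub w \<phi>0[of k] p by (intro powr_mono2) (auto simp: \<phi>_def)
      then have "\<kappa> * \<phi> k powr p \<le> (R / w powr p) * w powr p"
        using \<kappa> pos by (intro mult_mono) (auto simp: \<kappa>_def)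
      then have \<kappa>R: "\<kappa> * \<phi> k powr p \<le> R" using pos by simp
      have c\<Delta>: "0 < c * \<phi> k powr p" using c \<phi>0[of k] by simp
      have \<Delta>0: "0 < \<Delta> k" using c\<Delta> low by linarith
      have \<phi>z: "f (x k) - f z = \<phi> k" by (simp add: \<phi>_def z)
      have "c * \<phi> k powr p \<le> min (\<Delta> k) (\<kappa> * \<phi> k powr p)"
        using low c\<kappa> by (simp add: mult_right_mono)
      then have min_le: "c * \<phi> k powr p * \<phi> k / (2 * R * T)
          \<le> min (\<Delta> k) (\<kappa> * \<phi> k powr p) * \<phi> k / (2 * R * T)"
        using \<phi>0[of k] pos T by (intro divide_right_mono mult_right_mono) auto
      have "f z < f (x k)" using \<phi>0[of k] \<phi>z by simp
      note it = tr_iteration[OF cvx quad_model_error[OF tcd hoelder less_imp_le[OF pos(1)] pos(2)] step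
          pos(1,2) conjunct1[OF \<tau>] conjunct2[OF \<tau>] \<Delta>0 pos(4) \<kappa> _ z(2) this refl _ \<kappa>B,
          folded p_def T_def, unfolded \<phi>z]
      have "0 < \<eta>\<^sub>2" using \<eta> by linarith
      note it = it[OF this \<kappa>R]
      show ?thesis
        unfolding pred_def \<rho>_def using order_trans[OF min_le it(1)] it(2,3) by (intro conjI impI)
    qed
    have dec: "\<phi> (Suc k) \<le> \<phi> k - a * \<phi> k powr p * \<phi> k"
      if "\<eta>\<^sub>1 \<le> \<rho> k" "c * \<phi> k powr p * \<phi> k / (2 * R * T) \<le> pred k" "0 < pred k" for k
    proof -
      have "a * \<phi> k powr p * \<phi> k = \<eta>\<^sub>1 * (c * \<phi> k powr p * \<phi> k / (2 * R * T))"
        by (simp add: a_def)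
      also have "\<dots> \<le> \<eta>\<^sub>1 * pred k" using that \<eta> by (intro mult_left_mono) auto
      also have "\<dots> \<le> \<rho> k * pred k" using that by (intro mult_right_mono) auto
      also have "\<dots> = \<phi> k - \<phi> (Suc k)"
        using that by (simp add: \<rho>_def tr_ratio_def pred_def \<phi>_def next_x)
      finally show ?thesis by simp
    qed
    have inv: "f (x k) \<le> f x\<^sub>0 \<and> c * \<phi> k powr p \<le> \<Delta> k" for k
    proof (induction k)
      case 0
      have "\<phi> 0 powr p \<le> w powr p" using w \<phi>0[of 0] p by (intro powr_mono2) (auto simp: \<phi>_def init)
      then have "c * \<phi> 0 powr p \<le> (\<Delta>\<^sub>0 / w powr p) * w powr p"
        using c pos by (intro mult_mono) (auto simp: c_def)
      then show ?case using pos by (simp add: init)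
    next
      case (Suc k)
      note it = iter[OF conjunct1[OF Suc] conjunct2[OF Suc]]
      have c\<Delta>: "0 < c * \<phi> k powr p" using c \<phi>0[of k] by simp
      have \<Delta>0: "0 < \<Delta> k" using c\<Delta> Suc by linarith
      have le: "\<phi> (Suc k) \<le> \<phi> k"
      proof (cases "\<eta>\<^sub>1 \<le> \<rho> k")
        case True
        then have "\<phi> (Suc k) \<le> \<phi> k - a * \<phi> k powr p * \<phi> k" using dec it by blast
        moreover have "0 \<le> a * \<phi> k powr p * \<phi> k" using a \<phi>0[of k] by simp
        ultimately show ?thesis by linarith
      qed (simp add: \<phi>_def next_x)
      have "c * \<phi> k powr p \<le> \<Delta> (Suc k)"
      proof (cases "\<eta>\<^sub>2 \<le> \<rho> k")
        case True
        then show ?thesis using next_\<Delta>[of k] Suc \<eta> by (auto simp: tr_radius_update_def)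
      next
        \<comment> \<open>By contraposition of \<open>iter\<close> the radius exceeds the threshold
          \<open>\<kappa> * \<phi> k powr p\<close>, so even the strongest reduction leaves it above
          \<open>c * \<phi> k powr p\<close>.\<close>
        case False
        have "c * \<phi> k powr p \<le> \<gamma>\<^sub>1 * (\<kappa> * \<phi> k powr p)"
          unfolding mult.assoc[symmetric] by (intro mult_right_mono) (auto simp: c_def)
        also have "\<dots> \<le> \<gamma>\<^sub>1 * \<Delta> k" using False it \<gamma> by (intro mult_left_mono) auto
        also have "\<dots> \<le> \<Delta> (Suc k)"
          using next_\<Delta>[of k] False mult_right_mono[OF \<gamma>(2) less_imp_le[OF \<Delta>0]]
          by (auto simp: tr_radius_update_def split: if_splits)
        finally show ?thesis .
      qed
      moreover have "c * \<phi> (Suc k) powr p \<le> c * \<phi> k powr p"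
        using le c p \<phi>0[of "Suc k"] by (intro mult_left_mono powr_mono2) auto
      ultimately show ?case using le Suc by (simp add: \<phi>_def)
    qed
    have alt: "\<phi> (Suc k) \<le> \<phi> k - a * \<phi> k powr p * \<phi> k \<and> \<Delta> (Suc k) \<le> \<gamma>\<^sub>3 * \<Delta> k
        \<or> \<phi> (Suc k) = \<phi> k \<and> \<Delta> (Suc k) \<le> \<gamma>\<^sub>2 * \<Delta> k" for k
    proof (cases "\<eta>\<^sub>1 \<le> \<rho> k")
      case True
      have c\<Delta>: "0 < c * \<phi> k powr p" using c \<phi>0[of k] by simp
      have "0 \<le> \<Delta> k" using c\<Delta> inv[of k] by linarith
      then have "\<Delta> k \<le> \<gamma>\<^sub>3 * \<Delta> k" using \<gamma> by (simp add: mult_le_cancel_right1)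
      then have "\<Delta> (Suc k) \<le> \<gamma>\<^sub>3 * \<Delta> k"
        using next_\<Delta>[of k] True by (auto simp: tr_radius_update_def split: if_splits)
      moreover have "\<phi> (Suc k) \<le> \<phi> k - a * \<phi> k powr p * \<phi> k"
        using dec[OF True] iter inv by blast
      ultimately show ?thesis by blast
    next
      case False
      then show ?thesis using next_\<Delta>[of k] by (simp add: tr_radius_update_def next_x \<phi>_def)
    qed
    have "real k * (- ln \<gamma>\<^sub>2)
        \<le> ((ln \<gamma>\<^sub>3 - ln \<gamma>\<^sub>2) / (p * a) + 1 / c) * \<phi> k powr (- p) + ln (\<Delta> 0)"
      using p a c \<gamma> \<phi>0 inv alt by (intro potential_iteration_bound) auto
    then have "real k \<le> (((ln \<gamma>\<^sub>3 - ln \<gamma>\<^sub>2) / (p * a) + 1 / c) * \<phi> k powr (- p) + ln (\<Delta> 0)) / (- ln \<gamma>\<^sub>2)"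
      using \<gamma> by (subst pos_le_divide_eq) auto
    also have "\<dots> = C * \<phi> k powr (- p) + ln \<Delta>\<^sub>0 / (- ln \<gamma>\<^sub>2)"
      unfolding C_def init by (subst add_divide_distrib) (simp only: times_divide_eq_left)
    finally have "real k \<le> C * (f (x k) - fmin) powr (- 1 / (1 + \<nu>)) + ln \<Delta>\<^sub>0 / (- ln \<gamma>\<^sub>2)"
      by (simp add: \<phi>_def p_def)
  }
  then show ?thesis by blast
qed

section \<open>From the gap bound to the complexity estimate\<close>

theorem theorem13:
  fixes f :: "'a::euclidean_space \<Rightarrow> real"
    and grad :: "'a \<Rightarrow> 'a" and hess :: "'a \<Rightarrow> 'a \<Rightarrow>\<^sub>L 'a"
    and L \<nu> \<eta>\<^sub>1 \<eta>\<^sub>2 \<gamma>\<^sub>1 \<gamma>\<^sub>2 \<gamma>\<^sub>3 \<tau>\<^sub>b\<^sub>a\<^sub>r \<Delta>\<^sub>0 :: real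
    and \<tau> :: "nat \<Rightarrow> real" and x\<^sub>0 :: 'a
  assumes "convex_on UNIV f"
    and "twice_cont_diff f grad hess"
    and "bdd_below (range f)"
    and "minimizers f \<noteq> {}"
    and "L > 0" and "0 \<le> \<nu>" and "\<nu> \<le> 1"
    and "\<And>x y. norm (hess x - hess y) \<le> L * norm (x - y) powr \<nu>"
    and "sublevel_radius f x\<^sub>0 < \<infinity>"
    and "\<Delta>\<^sub>0 > 0"
    and "0 < \<eta>\<^sub>1" and "\<eta>\<^sub>1 \<le> \<eta>\<^sub>2" and "\<eta>\<^sub>2 < 1"
    and "0 < \<gamma>\<^sub>1" and "\<gamma>\<^sub>1 \<le> \<gamma>\<^sub>2" and "\<gamma>\<^sub>2 < 1" and "1 \<le> \<gamma>\<^sub>3"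
    and "\<tau>\<^sub>b\<^sub>a\<^sub>r > 0"
    and "\<And>k. 0 \<le> \<tau> k \<and> \<tau> k < \<tau>\<^sub>b\<^sub>a\<^sub>r"
  shows "\<exists>C>0. \<exists>\<epsilon>\<^sub>0>0. \<forall>x s \<Delta>.
           tr_run f grad hess \<eta>\<^sub>1 \<eta>\<^sub>2 \<gamma>\<^sub>1 \<gamma>\<^sub>2 \<gamma>\<^sub>3 \<tau> x\<^sub>0 \<Delta>\<^sub>0 x s \<Delta> \<longrightarrow>
           (\<forall>k. norm (grad (x k)) > 0 \<and> f (x k) - min_value f > 0) \<longrightarrow>
           (\<forall>\<epsilon>\<in>{0<..\<epsilon>\<^sub>0}. (\<exists>k. f (x k) - min_value f \<le> \<epsilon>) \<and>
              real (k_tr_cvx f x \<epsilon>) \<le> C * \<epsilon> powr (- 1 / (1 + \<nu>)))"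
proof -
  obtain z\<^sub>0 where z\<^sub>0: "z\<^sub>0 \<in> minimizers f" using assms(4) by blast
  have fmin: "f z = min_value f" if "z \<in> minimizers f" for z
    unfolding min_value_def using that
    by (intro cInf_eq_minimum[symmetric]) (auto simp: minimizers_def)
  define D where "D = real_of_ereal (sublevel_radius f x\<^sub>0)"
  \<comment> \<open>The extra 1 makes the distance bound strict, so a minimizer within
    \<open>R\<close> exists by the definition of the infimum, without an attainment
    argument.\<close>
  define R where "R = max 0 D + 1"
  have rad: "ereal (infdist y (minimizers f)) \<le> sublevel_radius f x\<^sub>0" if "f y \<le> f x\<^sub>0" for y
    unfolding sublevel_radius_def using that by (intro SUP_upper) auto
  have near: "\<exists>z. f z = min_value f \<and> norm (z - y) \<le> R" if "f y \<le> f x\<^sub>0" for y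
  proof -
    have "infdist y (minimizers f) \<le> D"
      using rad[OF that] assms(9) by (cases "sublevel_radius f x\<^sub>0") (auto simp: D_def)
    then have "infdist y (minimizers f) < R" by (simp add: R_def)
    then have "(INF z\<in>minimizers f. dist y z) < R"
      using assms(4) by (simp add: infdist_notempty)
    then obtain z where "z \<in> minimizers f" "dist y z < R"
      using assms(4) by (subst (asm) cINF_less_iff) auto
    then show ?thesis using fmin by (auto simp: dist_norm norm_minus_commute intro!: exI[of _ z])
  qed
  have R: "0 < R" by (simp add: R_def)
  \<comment> \<open>The summand 1 keeps the bound positive even if \<open>x\<^sub>0\<close> is
    optimal; that is excluded only once a nonterminating run is given.\<close>
  have w: "0 < f x\<^sub>0 - min_value f + 1"
    using z\<^sub>0 unfolding fmin[OF z\<^sub>0, symmetric] by (simp add: minimizers_def add_nonneg_pos)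
  have \<tau>: "0 \<le> \<tau> k \<and> \<tau> k \<le> \<tau>\<^sub>b\<^sub>a\<^sub>r" for k using assms(19)[of k] by simp
  obtain C where C: "\<forall>x s \<Delta>. tr_run f grad hess \<eta>\<^sub>1 \<eta>\<^sub>2 \<gamma>\<^sub>1 \<gamma>\<^sub>2 \<gamma>\<^sub>3 \<tau> x\<^sub>0 \<Delta>\<^sub>0 x s \<Delta> \<longrightarrow>
      (\<forall>k. norm (grad (x k)) > 0 \<and> f (x k) - min_value f > 0) \<longrightarrow>
      (\<forall>k. real k \<le> C * (f (x k) - min_value f) powr (- 1 / (1 + \<nu>)) + ln \<Delta>\<^sub>0 / (- ln \<gamma>\<^sub>2))"
    using tr_run_gap_bound[OF assms(1,2,5,6,10) R w assms(8) near less_imp_le[OF less_add_one]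
        assms(11-17) \<tau>] by (rule exE)
  \<comment> \<open>For \<open>\<epsilon> \<le> 1\<close>, the choice made for
    \<open>\<epsilon>\<^sub>0\<close>, the power \<open>E\<close> is at least 1, so additive
    constants are absorbed into \<open>K * E\<close>. The last 1 pays for passing from an index to
    its successor.\<close>
  define K where "K = \<bar>C\<bar> + \<bar>ln \<Delta>\<^sub>0 / (- ln \<gamma>\<^sub>2)\<bar> + 1"
  have K: "0 < K" by (simp add: K_def add_nonneg_pos)
  {
    fix x s \<Delta> and \<epsilon> :: real
    assume run: "tr_run f grad hess \<eta>\<^sub>1 \<eta>\<^sub>2 \<gamma>\<^sub>1 \<gamma>\<^sub>2 \<gamma>\<^sub>3 \<tau> x\<^sub>0 \<Delta>\<^sub>0 x s \<Delta>"
      and live: "\<forall>k. norm (grad (x k)) > 0 \<and> f (x k) - min_value f > 0"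
      and \<epsilon>: "0 < \<epsilon>" "\<epsilon> \<le> 1"
    define E where "E = \<epsilon> powr (- 1 / (1 + \<nu>))"
    have E: "1 \<le> E" using powr_mono2'[of "- 1 / (1 + \<nu>)" \<epsilon> 1] \<epsilon> assms(6) by (simp add: E_def)
    have C': "\<forall>k. real k \<le> C * (f (x k) - min_value f) powr (- 1 / (1 + \<nu>)) + ln \<Delta>\<^sub>0 / (- ln \<gamma>\<^sub>2)"
      using C run live by blast
    have bound: "real k + 1 \<le> K * E" if "\<epsilon> < f (x k) - min_value f" for k
    proof -
      have "(f (x k) - min_value f) powr (- 1 / (1 + \<nu>)) \<le> E"
        unfolding E_def using that \<epsilon> assms(6) by (intro powr_mono2') auto
      then have "C * (f (x k) - min_value f) powr (- 1 / (1 + \<nu>)) \<le> \<bar>C\<bar> * E"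
        by (intro mult_mono) auto
      moreover have "ln \<Delta>\<^sub>0 / (- ln \<gamma>\<^sub>2) \<le> \<bar>ln \<Delta>\<^sub>0 / (- ln \<gamma>\<^sub>2)\<bar> * E"
        using mult_left_mono[OF E, of "\<bar>ln \<Delta>\<^sub>0 / (- ln \<gamma>\<^sub>2)\<bar>"] by linarith
      ultimately show ?thesis using spec[OF C', of k] E unfolding K_def distrib_right by linarith
    qed
    have ex: "\<exists>k. f (x k) - min_value f \<le> \<epsilon>"
    proof (rule ccontr)
      assume "\<nexists>k. f (x k) - min_value f \<le> \<epsilon>"
      then have none: "real k + 1 \<le> K * E" for k by (intro bound) (simp add: not_le)
      obtain k where "K * E < real k" using reals_Archimedean2 by blast
      with none[of k] show False by linarith
    qed
    moreover have "real (k_tr_cvx f x \<epsilon>) \<le> K * E"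
    proof (cases "k_tr_cvx f x \<epsilon>")
      case 0
      then show ?thesis using K E by simp
    next
      \<comment> \<open>The predecessor of the least index still has a gap above
        \<open>\<epsilon>\<close>, and \<open>bound\<close> already counts its successor.\<close>
      case (Suc k)
      then have "\<not> f (x k) - min_value f \<le> \<epsilon>" unfolding k_tr_cvx_def by (metis lessI not_less_Least)
      then show ?thesis using bound[of k] Suc by simp
    qed
    ultimately have "(\<exists>k. f (x k) - min_value f \<le> \<epsilon>)
        \<and> real (k_tr_cvx f x \<epsilon>) \<le> K * \<epsilon> powr (- 1 / (1 + \<nu>))"
      by (simp add: E_def)
  }
  then show ?thesis
    by - (rule exI[of _ K], rule conjI[OF K], rule exI[of _ 1], auto)
qed

end
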